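(* Let $G_\sigma$ be a signed graph with at least three vertices that is sign connected and whose underlying graph is a block. Then $G_\sigma$ is a sign block if and only if $G_\sigma$ has no balancing vertex.
   Context: A signed graph $G_\sigma=(V,E;\sigma)$ consists of a finite undirected graph $G=(V,E)$, in which loops and multiple edges are allowed, together with a map $\sigma:E\to\{-1,+1\}$. Cycles are elementary; a loop is a cycle of length 1. Chains are walks. The sign of a cycle or chain is the product of the signs of its edges, counted with multiplicity. $G_\sigma$ is balanced if every cycle is positive. Two vertices $x,y$ are sign connected if $x=y$ or there exist both a positive and a negative chain joining them. $G_\sigma$ is sign connected if every two vertices are sign connected. An articulation vertex of a graph is a vertex $v$ for which there exist edges $e,f$ such that every chain from $e$ to $f$ passes through $v$. A vertex supporting a loop is an articulation vertex unless it is incident with no other edge. A block is a maximal subgraph with no articulation vertex; the graph "is a block" if it has no articulation vertex. A sign articulation vertex of a sign-connected signed graph $G_\sigma$ is a vertex $x$ such that $G_\sigma-x$ (delete $x$ and its incident edges) is not sign connected. A sign-connected $G_\sigma$ is a sign block if it has no sign articulation vertex. A balancing vertex is a vertex $x$ such that $G_\sigma-x$ is balanced. *)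

theory Defs
  imports Main
begin

text \<open>
  Edges carry names, so multiple edges are allowed. An edge is mapped to the set of its ends;
  a loop at \<open>v\<close> is an edge with \<open>ends G e = {v}\<close>.
\<close>

record ('v, 'e) pre_multigraph =
  verts :: "'v set"
  edges :: "'e set"
  ends :: "'e \<Rightarrow> 'v set"

record ('v, 'e) pre_signed_graph = "('v, 'e) pre_multigraph" +
  esign :: "'e \<Rightarrow> int"

text \<open>
  Everything that does not mention signs is defined for record schemes, so for a signed graph
  it refers to the underlying graph.
\<close>

locale multigraph =
  fixes G :: "('v, 'e, 'z) pre_multigraph_scheme"
  assumes finite_verts: "finite (verts G)"
    and finite_edges: "finite (edges G)"
    and ends_in_verts: "e \<in> edges G \<Longrightarrow> ends G e \<subseteq> verts G"
    and card_ends: "e \<in> edges G \<Longrightarrow> card (ends G e) \<in> {1, 2}"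

locale signed_graph = multigraph G
  for G :: "('v, 'e, 'z) pre_signed_graph_scheme" +
  assumes esign_values: "e \<in> edges G \<Longrightarrow> esign G e \<in> {-1, 1}"

text \<open>
  A chain (walk) is given by its vertex sequence \<open>vs\<close> and its edge sequence \<open>es\<close>; repetitions are
  allowed, and \<open>chain G [v] []\<close> is the trivial chain at \<open>v\<close>.
\<close>

definition chain :: "('v, 'e, 'z) pre_multigraph_scheme \<Rightarrow> 'v list \<Rightarrow> 'e list \<Rightarrow> bool" where
  "chain G vs es \<longleftrightarrow>
     length vs = Suc (length es) \<and> set vs \<subseteq> verts G \<and> set es \<subseteq> edges G \<and>
     (\<forall>i < length es. ends G (es ! i) = {vs ! i, vs ! Suc i})"

definition chain_joins ::
  "('v, 'e, 'z) pre_multigraph_scheme \<Rightarrow> 'v \<Rightarrow> 'v list \<Rightarrow> 'e list \<Rightarrow> 'v \<Rightarrow> bool" where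
  "chain_joins G x vs es y \<longleftrightarrow> chain G vs es \<and> hd vs = x \<and> last vs = y"

text \<open>
  Requiring distinct edges only matters for length 2, where it excludes running back and forth
  along one edge.
\<close>

definition cycle :: "('v, 'e, 'z) pre_multigraph_scheme \<Rightarrow> 'v list \<Rightarrow> 'e list \<Rightarrow> bool" where
  "cycle G vs es \<longleftrightarrow>
     chain G vs es \<and> es \<noteq> [] \<and> hd vs = last vs \<and> distinct (tl vs) \<and> distinct es"

definition delete_vertex ::
  "('v, 'e, 'z) pre_multigraph_scheme \<Rightarrow> 'v \<Rightarrow> ('v, 'e, 'z) pre_multigraph_scheme" where
  "delete_vertex G x = G\<lparr>verts := verts G - {x}, edges := {e \<in> edges G. x \<notin> ends G e}\<rparr>"

definition chain_from_edge_to_edge ::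
  "('v, 'e, 'z) pre_multigraph_scheme \<Rightarrow> 'e \<Rightarrow> 'v list \<Rightarrow> 'e list \<Rightarrow> 'e \<Rightarrow> bool" where
  "chain_from_edge_to_edge G e vs es f \<longleftrightarrow>
     chain G vs es \<and> es \<noteq> [] \<and> hd es = e \<and> last es = f"

text \<open>
  A chain from an edge to an edge has these edges as first and last edge, and it passes through
  its interior vertices only: if end vertices counted, every vertex incident with an edge would be
  an articulation vertex (take \<open>e = f\<close>).
\<close>

definition passes_through :: "'v list \<Rightarrow> 'v \<Rightarrow> bool" where
  "passes_through vs v \<longleftrightarrow> (\<exists>i. 0 < i \<and> Suc i < length vs \<and> vs ! i = v)"

definition articulation_vertex :: "('v, 'e, 'z) pre_multigraph_scheme \<Rightarrow> 'v \<Rightarrow> bool" where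
  "articulation_vertex G v \<longleftrightarrow>
     v \<in> verts G \<and>
     (\<exists>e \<in> edges G. \<exists>f \<in> edges G.
        \<forall>vs es. chain_from_edge_to_edge G e vs es f \<longrightarrow> passes_through vs v)"

definition is_block :: "('v, 'e, 'z) pre_multigraph_scheme \<Rightarrow> bool" where
  "is_block G \<longleftrightarrow> (\<nexists>v. articulation_vertex G v)"

lemma loop_articulation_vertex:
  assumes "v \<in> verts G" "e \<in> edges G" "ends G e = {v}"
    and "f \<in> edges G" "f \<noteq> e"
  shows "articulation_vertex G v"
proof -
  have "passes_through vs v" if "chain_from_edge_to_edge G e vs es f" for vs es
  proof -
    from that have c: "chain G vs es" and es: "es \<noteq> []" "hd es = e" "last es = f"
      by (auto simp: chain_from_edge_to_edge_def)
    then obtain es' where es': "es = e # es'" by (cases es) auto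
    with es assms(5) have "es' \<noteq> []" by auto
    moreover have "vs ! 1 = v"
      using c assms(3) by (auto simp: chain_def es' doubleton_eq_iff)
    ultimately show ?thesis
      using c unfolding passes_through_def chain_def es' by (intro exI[of _ 1]) auto
  qed
  with assms show ?thesis unfolding articulation_vertex_def by blast
qed

lemma single_loop_not_articulation_vertex:
  assumes "v \<in> verts G" "edges G = {e}" "ends G e = {v}"
  shows "\<not> articulation_vertex G v"
proof -
  have "chain_from_edge_to_edge G e [v, v] [e] e"
    using assms by (auto simp: chain_from_edge_to_edge_def chain_def)
  moreover have "\<not> passes_through [v, v] v" by (auto simp: passes_through_def)
  ultimately show ?thesis using assms(2) unfolding articulation_vertex_def by auto
qed

definition chain_sign :: "('v, 'e, 'z) pre_signed_graph_scheme \<Rightarrow> 'e list \<Rightarrow> int" where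
  "chain_sign G es = (\<Prod>e\<leftarrow>es. esign G e)"

definition balanced :: "('v, 'e, 'z) pre_signed_graph_scheme \<Rightarrow> bool" where
  "balanced G \<longleftrightarrow> (\<forall>vs es. cycle G vs es \<longrightarrow> chain_sign G es = 1)"

definition sign_connected_verts ::
  "('v, 'e, 'z) pre_signed_graph_scheme \<Rightarrow> 'v \<Rightarrow> 'v \<Rightarrow> bool" where
  "sign_connected_verts G x y \<longleftrightarrow>
     x = y \<or>
     ((\<exists>vs es. chain_joins G x vs es y \<and> chain_sign G es = 1) \<and>
      (\<exists>vs es. chain_joins G x vs es y \<and> chain_sign G es = -1))"

definition sign_connected :: "('v, 'e, 'z) pre_signed_graph_scheme \<Rightarrow> bool" where
  "sign_connected G \<longleftrightarrow> (\<forall>x \<in> verts G. \<forall>y \<in> verts G. sign_connected_verts G x y)"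

definition sign_articulation_vertex :: "('v, 'e, 'z) pre_signed_graph_scheme \<Rightarrow> 'v \<Rightarrow> bool" where
  "sign_articulation_vertex G x \<longleftrightarrow>
     sign_connected G \<and> x \<in> verts G \<and> \<not> sign_connected (delete_vertex G x)"

definition sign_block :: "('v, 'e, 'z) pre_signed_graph_scheme \<Rightarrow> bool" where
  "sign_block G \<longleftrightarrow> sign_connected G \<and> (\<nexists>x. sign_articulation_vertex G x)"

definition balancing_vertex :: "('v, 'e, 'z) pre_signed_graph_scheme \<Rightarrow> 'v \<Rightarrow> bool" where
  "balancing_vertex G x \<longleftrightarrow> x \<in> verts G \<and> balanced (delete_vertex G x)"

end

theory Submission
  imports Defs
begin

text \<open>
  A closed negative chain contains a negative cycle, so in a balanced graph no two distinct
  vertices are sign connected. Conversely, in a connected unbalanced graph every chain can be given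
  the opposite sign by a detour around a negative cycle. Deleting a vertex from a connected block
  leaves a connected graph, so \<open>G - x\<close> is sign connected iff it is unbalanced.
\<close>

section \<open>Chains\<close>

lemma chain_single [simp]: "chain G [v] es \<longleftrightarrow> es = [] \<and> v \<in> verts G"
  by (auto simp: chain_def)

lemma chain_Cons [simp]:
  "chain G (u # v # vs) (e # es) \<longleftrightarrow>
     u \<in> verts G \<and> e \<in> edges G \<and> ends G e = {u, v} \<and> chain G (v # vs) es"
  by (auto simp: chain_def All_less_Suc2)

text \<open>The gluing vertex \<open>v\<close> is both the end of the first chain and the start of
  the second; the length hypothesis aligns the cut in the edge list with the one in the vertex
  list.\<close>

lemma chain_append:
  assumes "length es = length us"
  shows "chain G (us @ v # vs) (es @ fs) \<longleftrightarrow> chain G (us @ [v]) es \<and> chain G (v # vs) fs"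
  using assms
proof (induction us arbitrary: es)
  case Nil
  have "v \<in> verts G" if "chain G (v # vs) fs"
    using that by (auto simp: chain_def)
  with Nil show ?case by auto
next
  case (Cons u us)
  then obtain e es' where "es = e # es'" "length es' = length us"
    by (cases es) auto
  with Cons.IH[of es'] show ?case by (cases us) auto
qed

lemma chain_rev:
  assumes "chain G vs es"
  shows "chain G (rev vs) (rev es)"
  using assms
proof (induction es arbitrary: vs)
  case Nil
  then show ?case by (auto simp: chain_def length_Suc_conv)
next
  case (Cons e es)
  then have "length vs = Suc (Suc (length es))" by (simp add: chain_def)
  then obtain u v ws where vs: "vs = u # v # ws" by (metis length_Suc_conv)
  with Cons.prems have e: "u \<in> verts G" "e \<in> edges G" "ends G e = {v, u}"
    and tail: "chain G (v # ws) es"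
    by (simp_all add: insert_commute)
  from tail have v: "v \<in> verts G" and len: "length (rev es) = length (rev ws)"
    by (auto simp: chain_def)
  from Cons.IH[OF tail] have "chain G (rev ws @ [v]) (rev es)" by simp
  then have "chain G (rev ws @ v # [u]) (rev es @ [e])"
    using e v by (subst chain_append[OF len]) simp
  then show ?case by (simp add: vs)
qed

lemma chain_sign_append: "chain_sign G (es @ fs) = chain_sign G es * chain_sign G fs"
  by (simp add: chain_sign_def)

lemma chain_sign_rev: "chain_sign G (rev es) = chain_sign G es"
  by (induction es) (simp_all add: chain_sign_def)

lemma (in signed_graph) chain_sign_values:
  assumes "set es \<subseteq> edges G"
  shows "chain_sign G es \<in> {-1, 1}"
  using assms
proof (induction es)
  case (Cons e es)
  then have "esign G e \<in> {-1, 1}" "chain_sign G es \<in> {-1, 1}"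
    using esign_values[of e] by simp_all
  then show ?case by (auto simp: chain_sign_def)
qed (simp add: chain_sign_def)

text \<open>The sign is a parameter so that concatenation becomes multiplication. Some
  \<open>s\<close> existing expresses ordinary connectedness, and \<open>x = y\<close> with
  \<open>s = -1\<close> is a negative closed chain at \<open>x\<close>.\<close>

definition joined_with_sign ::
  "('v, 'e, 'z) pre_signed_graph_scheme \<Rightarrow> 'v \<Rightarrow> int \<Rightarrow> 'v \<Rightarrow> bool" where
  "joined_with_sign G x s y \<longleftrightarrow> (\<exists>vs es. chain_joins G x vs es y \<and> chain_sign G es = s)"

lemma joined_with_sign_trans:
  assumes "joined_with_sign G x s y" "joined_with_sign G y t z"
  shows "joined_with_sign G x (s * t) z"
proof -
  from assms obtain us es vs fs where
    c: "chain G us es" "chain G vs fs"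
    and h: "hd us = x" "last us = y" "hd vs = y" "last vs = z"
    and s: "chain_sign G es = s" "chain_sign G fs = t"
    by (auto simp: joined_with_sign_def chain_joins_def)
  from c have len: "length us = Suc (length es)" "length vs = Suc (length fs)"
    by (auto simp: chain_def)
  from len h obtain us' where us: "us = us' @ [y]" by (cases us rule: rev_cases) auto
  from len h obtain vs' where vs: "vs = y # vs'" by (cases vs) auto
  have "chain G (us' @ y # vs') (es @ fs)"
    using c len by (subst chain_append) (auto simp: us vs)
  moreover have "hd (us' @ y # vs') = x" using h us by (cases us') auto
  moreover have "last (us' @ y # vs') = z" using h vs by simp
  ultimately show ?thesis
    unfolding joined_with_sign_def chain_joins_def using s chain_sign_append by blast
qed

lemma joined_with_sign_sym:
  assumes "joined_with_sign G x s y"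
  shows "joined_with_sign G y s x"
proof -
  from assms obtain vs es where c: "chain G vs es" "hd vs = x" "last vs = y" "chain_sign G es = s"
    by (auto simp: joined_with_sign_def chain_joins_def)
  then have "vs \<noteq> []" by (auto simp: chain_def)
  with c show ?thesis
    unfolding joined_with_sign_def chain_joins_def
    by (metis chain_rev chain_sign_rev hd_rev last_rev)
qed

lemma (in signed_graph) joined_with_sign_values:
  assumes "joined_with_sign G x s y"
  shows "s \<in> {-1, 1}"
  using assms chain_sign_values
  by (auto simp: joined_with_sign_def chain_joins_def chain_def)

lemma sign_connected_verts_iff:
  "sign_connected_verts G x y \<longleftrightarrow>
     x = y \<or> joined_with_sign G x 1 y \<and> joined_with_sign G x (-1) y"
  by (simp add: sign_connected_verts_def joined_with_sign_def)

section \<open>Negative closed chains and negative cycles\<close>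

text \<open>Two occurrences of one edge have the same pair of ends. Only the first vertex may recur,
  so the occurrences must be adjacent, start at index 0, and exhaust the chain.\<close>

lemma closed_chain_backtracks:
  assumes c: "chain G vs es" and closed: "hd vs = last vs"
    and dvs: "distinct (tl vs)" and des: "\<not> distinct es"
  shows "\<exists>e. es = [e, e]"
proof -
  have len: "length vs = Suc (length es)"
    and ends: "\<And>i. i < length es \<Longrightarrow> ends G (es ! i) = {vs ! i, vs ! Suc i}"
    using c by (auto simp: chain_def)
  \<comment> \<open>Index 0 is excluded because \<open>tl vs\<close> omits it, and closedness makes
    the first vertex recur at the end.\<close>
  have inj: "k = l" if "vs ! k = vs ! l" "0 < k" "0 < l" "k \<le> length es" "l \<le> length es" for k l
  proof -
    have "tl vs ! (k - 1) = tl vs ! (l - 1)" using that len by (simp add: nth_tl)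
    then have "k - 1 = l - 1" using dvs that len by (subst (asm) nth_eq_iff_index_eq) auto
    with that show ?thesis by simp
  qed
  obtain i j where ij: "i < j" "j < length es" "es ! i = es ! j"
    using des by (metis distinct_conv_nth nat_neq_iff)
  have *: "{vs ! i, vs ! Suc i} = {vs ! j, vs ! Suc j}"
    using ends[of i] ends[of j] ij by simp
  have "vs ! Suc i \<noteq> vs ! Suc j" using inj[of "Suc i" "Suc j"] ij by auto
  \<comment> \<open>The two occurrences cannot run in the same direction, so their ends match
    crosswise.\<close>
  with * have eq: "vs ! Suc i = vs ! j" "vs ! i = vs ! Suc j" by (auto simp: doubleton_eq_iff)
  have j: "j = Suc i" using inj[of "Suc i" j] eq(1) ij by auto
  have i: "i = 0" using inj[of i "Suc j"] eq(2) ij by auto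
  \<comment> \<open>Both sides equal \<open>vs ! 0\<close>: the left by closedness, the right by the
    crosswise match with \<open>i = 0\<close> and \<open>j = 1\<close>.\<close>
  have "vs ! length es = vs ! 2"
    using closed len eq(2) i j last_conv_nth[of vs] hd_conv_nth[of vs]
    by (fastforce simp: numeral_2_eq_2)
  then have "length es = 2" using inj[of "length es" 2] ij i j by fastforce
  then obtain a b where "es = [a, b]" by (auto simp: numeral_2_eq_2 length_Suc_conv)
  with ij i j show ?thesis by auto
qed

text \<open>Induction on length: a vertex repeated after the start splits off a closed chain and
  leaves a shorter closed one. Their signs multiply to -1, so one of them is negative. Without such
  a repetition, only backtracking along one edge could prevent a cycle.\<close>

lemma (in signed_graph) negative_cycle_if_negative_closed_chain:
  assumes "chain G vs es" "hd vs = last vs" "chain_sign G es = -1"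
  shows "\<exists>vs es. cycle G vs es \<and> chain_sign G es = -1"
  using assms
proof (induction "length es" arbitrary: vs es rule: less_induct)
  case less
  note c = less.prems(1)
  have len: "length vs = Suc (length es)" using c by (simp add: chain_def)
  show ?case
  proof (cases "distinct (tl vs)")
    case True
    have "distinct es"
    proof (rule ccontr)
      assume "\<not> distinct es"
      then obtain e where e: "es = [e, e]"
        using closed_chain_backtracks[OF c less.prems(2) True] by auto
      \<comment> \<open>Traversing an edge twice contributes the square of its sign, which is
        1.\<close>
      then have "esign G e \<in> {-1, 1}" using c esign_values by (auto simp: chain_def)
      with e less.prems(3) show False by (auto simp: chain_sign_def)
    qed
    moreover have "es \<noteq> []" using less.prems(3) by (auto simp: chain_sign_def)
    ultimately have "cycle G vs es" using less.prems True by (simp add: cycle_def)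
    with less.prems(3) show ?thesis by blast
  next
    case False
    then obtain as bs cs y where "tl vs = as @ [y] @ bs @ [y] @ cs"
      using not_distinct_decomp by blast
    with len obtain v where vs: "vs = (v # as) @ y # bs @ y # cs" by (cases vs) auto
    define es1 es2 es3 where "es1 = take (Suc (length as)) es"
      and "es2 = take (Suc (length bs)) (drop (Suc (length as)) es)"
      and "es3 = drop (Suc (length bs)) (drop (Suc (length as)) es)"
    have es: "es = es1 @ es2 @ es3" by (simp add: es1_def es2_def es3_def del: drop_drop)
    \<comment> \<open>Both \<open>es1\<close> and \<open>es2\<close> are nonempty, so
      \<open>es2\<close> and \<open>es1 @ es3\<close> are each strictly shorter than
      \<open>es\<close>.\<close>
    have len': "length es1 = length (v # as)" "length es2 = length (y # bs)"
      using len by (auto simp: es1_def es2_def vs)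
    have "chain G (v # as @ [y]) es1" and 23: "chain G (y # bs @ y # cs) (es2 @ es3)"
      using c chain_append[OF len'(1), of G y "bs @ y # cs" "es2 @ es3"] by (simp_all add: vs es)
    moreover have loop: "chain G (y # bs @ [y]) es2" and "chain G (y # cs) es3"
      using 23 chain_append[OF len'(2), of G y cs es3] by simp_all
    ultimately have rest: "chain G (v # as @ y # cs) (es1 @ es3)"
      using chain_append[OF len'(1), of G y cs es3] by simp
    have "chain_sign G es2 \<in> {-1, 1}"
      using c by (intro chain_sign_values) (auto simp: chain_def es)
    moreover have "chain_sign G es2 * chain_sign G (es1 @ es3) = -1"
      using less.prems(3) by (simp add: es chain_sign_append ac_simps)
    ultimately consider "chain_sign G es2 = -1" | "chain_sign G (es1 @ es3) = -1" by auto
    then show ?thesis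
    proof cases
      case 1
      then show ?thesis using less.hyps[OF _ loop] len' by (simp add: es)
    next
      case 2
      have "hd (v # as @ y # cs) = last (v # as @ y # cs)" using less.prems(2) by (simp add: vs)
      then show ?thesis using less.hyps[OF _ rest _ 2] len' by (simp add: es)
    qed
  qed
qed

lemma (in signed_graph) balanced_iff:
  "balanced G \<longleftrightarrow> (\<nexists>x. joined_with_sign G x (-1) x)"
proof
  assume "balanced G"
  then show "\<nexists>x. joined_with_sign G x (-1) x"
    using negative_cycle_if_negative_closed_chain
    by (fastforce simp: balanced_def joined_with_sign_def chain_joins_def)
next
  assume *: "\<nexists>x. joined_with_sign G x (-1) x"
  show "balanced G"
    unfolding balanced_def
  proof (intro allI impI)
    fix vs es assume "cycle G vs es"
    then have c: "chain G vs es" "hd vs = last vs" by (auto simp: cycle_def)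
    with * have "chain_sign G es \<noteq> -1"
      unfolding joined_with_sign_def chain_joins_def by metis
    moreover have "chain_sign G es \<in> {-1, 1}"
      using c by (intro chain_sign_values) (auto simp: chain_def)
    ultimately show "chain_sign G es = 1" by simp
  qed
qed

text \<open>A negative closed chain at one vertex can be moved to any \<open>x\<close> by walking
  there and back, since the connecting chain is used twice. Prefixing it to a chain from
  \<open>x\<close> flips the sign.\<close>

lemma (in signed_graph) sign_connected_if_unbalanced:
  assumes conn: "\<And>x y. x \<in> verts G \<Longrightarrow> y \<in> verts G \<Longrightarrow> x \<noteq> y \<Longrightarrow> \<exists>s. joined_with_sign G x s y"
    and "\<not> balanced G"
  shows "sign_connected G"
  unfolding sign_connected_def sign_connected_verts_iff
proof (intro ballI)
  fix x y assume xy: "x \<in> verts G" "y \<in> verts G"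
  obtain z where z: "joined_with_sign G z (-1) z" using assms(2) balanced_iff by auto
  then have "z \<in> verts G"
    unfolding joined_with_sign_def chain_joins_def chain_def
    by (metis Zero_not_Suc hd_in_set list.size(3) subsetD)
  then have "joined_with_sign G x (-1) x"
  proof (cases "x = z")
    case False
    then obtain t where t: "joined_with_sign G x t z" using conn xy(1) \<open>z \<in> verts G\<close> by blast
    have "joined_with_sign G x (t * -1 * t) x"
      using joined_with_sign_trans[OF joined_with_sign_trans[OF t z] joined_with_sign_sym[OF t]] .
    with joined_with_sign_values[OF t] show ?thesis by auto
  qed (use z in simp)
  then have "joined_with_sign G x (- s) y" if "joined_with_sign G x s y" for s
    using joined_with_sign_trans[of G x "-1" x s y] that by simp
  then show "x = y \<or> joined_with_sign G x 1 y \<and> joined_with_sign G x (-1) y"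
    using conn[OF xy] joined_with_sign_values by fastforce
qed

section \<open>Deleting a vertex\<close>

lemma delete_vertex_simps [simp]:
  "verts (delete_vertex G x) = verts G - {x}"
  "edges (delete_vertex G x) = {e \<in> edges G. x \<notin> ends G e}"
  "ends (delete_vertex G x) = ends G"
  by (simp_all add: delete_vertex_def)

lemma esign_delete_vertex [simp]: "esign (delete_vertex G x) = esign G"
  by (simp add: delete_vertex_def)

lemma (in signed_graph) signed_graph_delete_vertex: "signed_graph (delete_vertex G x)"
  using finite_verts finite_edges ends_in_verts card_ends esign_values
  by unfold_locales auto

text \<open>No condition on edges is required, because the ends of every edge used lie on the
  chain.\<close>

lemma chain_delete_vertex_iff:
  "chain (delete_vertex G x) vs es \<longleftrightarrow> chain G vs es \<and> x \<notin> set vs"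
proof -
  have "x \<notin> ends G e" if c: "chain G vs es" "x \<notin> set vs" and e: "e \<in> set es" for e
  proof -
    obtain i where i: "i < length es" "e = es ! i" using e by (auto simp: in_set_conv_nth)
    then have "vs ! i \<in> set vs" "vs ! Suc i \<in> set vs" "ends G e = {vs ! i, vs ! Suc i}"
      using c(1) by (simp_all add: chain_def)
    then show ?thesis using c(2) by auto
  qed
  then show ?thesis unfolding chain_def by auto
qed

text \<open>Articulation vertices are defined through pairs of edges; this turns a pair of vertices
  into such a pair.\<close>

lemma (in signed_graph) incident_edge:
  assumes "sign_connected G" "u \<in> verts G" "w \<in> verts G" "u \<noteq> w"
  shows "\<exists>e \<in> edges G. u \<in> ends G e"
proof -
  obtain vs es where c: "chain G vs es" "hd vs = u" "last vs = w"
    using assms unfolding sign_connected_def sign_connected_verts_def chain_joins_def by metis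
  then have len: "length vs = Suc (length es)" by (simp add: chain_def)
  then have "es \<noteq> []" using c \<open>u \<noteq> w\<close> by (auto simp: length_Suc_conv)
  then have "es ! 0 \<in> edges G" "ends G (es ! 0) = {vs ! 0, vs ! Suc 0}"
    using c by (auto simp: chain_def)
  moreover have "vs ! 0 = u" using c len by (metis hd_conv_nth length_0_conv nat.distinct(1))
  ultimately show ?thesis by (metis insertI1)
qed

lemma chain_segment:
  assumes "chain G vs es" "i \<le> j" "j < length vs"
  shows "chain G (take (Suc j - i) (drop i vs)) (take (j - i) (drop i es))"
proof -
  have "set (take (Suc j - i) (drop i vs)) \<subseteq> set vs" "set (take (j - i) (drop i es)) \<subseteq> set es"
    by (meson in_set_dropD in_set_takeD subsetI)+
  with assms show ?thesis unfolding chain_def by (simp add: Suc_diff_le) blast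
qed

text \<open>As \<open>x\<close> is not an articulation vertex, some chain from an edge at
  \<open>u\<close> to an edge at \<open>w\<close> avoids \<open>x\<close> in its interior. Its part
  between \<open>u\<close> and \<open>w\<close> avoids \<open>x\<close> altogether.\<close>

lemma (in signed_graph) delete_vertex_connected:
  assumes sc: "sign_connected G" and blk: "is_block G" and x: "x \<in> verts G"
    and u: "u \<in> verts G" "u \<noteq> x" and w: "w \<in> verts G" "w \<noteq> x" and uw: "u \<noteq> w"
  shows "\<exists>s. joined_with_sign (delete_vertex G x) u s w"
proof -
  obtain e where e: "e \<in> edges G" "u \<in> ends G e" using incident_edge[OF sc u(1) w(1) uw] by auto
  obtain f where f: "f \<in> edges G" "w \<in> ends G f" using incident_edge[OF sc w(1) u(1)] uw by auto
  obtain vs es where "chain_from_edge_to_edge G e vs es f" and np: "\<not> passes_through vs x"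
    using blk x e(1) f(1) unfolding is_block_def articulation_vertex_def by blast
  then have c: "chain G vs es" and ne: "es \<noteq> []" "hd es = e" "last es = f"
    by (auto simp: chain_from_edge_to_edge_def)
  define n where "n = length es"
  have n: "0 < n" "length vs = Suc n"
    and ends: "\<And>i. i < n \<Longrightarrow> ends G (es ! i) = {vs ! i, vs ! Suc i}"
    using c ne by (auto simp: chain_def n_def)
  have "e = es ! 0" "f = es ! (n - 1)"
    using ne by (simp_all add: hd_conv_nth last_conv_nth n_def)
  \<comment> \<open>Each edge may be traversed in either direction, so \<open>u\<close> is one of
    the first two vertices and \<open>w\<close> one of the last two.\<close>
  then obtain i j where i: "i \<le> 1" "vs ! i = u" and j: "n - 1 \<le> j" "j \<le> n" "vs ! j = w"
    using e(2) f(2) ends[of 0] ends[of "n - 1"] n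
    by (metis One_nat_def Suc_pred diff_le_self diff_less insertE le_refl less_one singletonD zero_le)
  have segment: "\<exists>s. joined_with_sign (delete_vertex G x) (vs ! k) s (vs ! l)"
    if kl: "k \<le> l" "l \<le> n" "vs ! k \<noteq> x" "vs ! l \<noteq> x" for k l
  proof -
    let ?us = "take (Suc l - k) (drop k vs)" and ?fs = "take (l - k) (drop k es)"
    \<comment> \<open>Interior vertices of the whole chain differ from \<open>x\<close> by
      \<open>np\<close>; the ends of the segment, which may be ends of the chain, differ from it by
      assumption.\<close>
    have avoids: "vs ! m \<noteq> x" if "k \<le> m" "m \<le> l" for m
    proof (cases "m = k \<or> m = l")
      case False
      then have "0 < m" "Suc m < length vs" using that kl n by auto
      then show ?thesis using np unfolding passes_through_def by metis
    qed (use kl in auto)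
    have "x \<notin> set ?us"
    proof
      assume "x \<in> set ?us"
      then obtain p where p: "p < length ?us" "?us ! p = x" unfolding in_set_conv_nth by blast
      then have "k + p \<le> l" "vs ! (k + p) = x" using kl n by auto
      with avoids show False by simp
    qed
    then have "chain (delete_vertex G x) ?us ?fs"
      using chain_segment[OF c kl(1)] kl n by (simp add: chain_delete_vertex_iff)
    moreover have "hd ?us = vs ! k" "last ?us = vs ! l"
      using kl n by (auto simp: hd_conv_nth last_conv_nth)
    ultimately show ?thesis
      unfolding joined_with_sign_def chain_joins_def by blast
  qed
  show ?thesis
  proof (cases "i \<le> j")
    case True
    then show ?thesis using segment[of i j] i j u w by simp
  next
    case False
    \<comment> \<open>Here \<open>n = 1\<close>, \<open>i = 1\<close> and \<open>j = 0\<close>: a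
      single edge traversed from \<open>w\<close> to \<open>u\<close>, to be reversed.\<close>
    then show ?thesis using segment[of j i] i j u w n joined_with_sign_sym by fastforce
  qed
qed

text \<open>Three vertices leave two distinct ones after the deletion; a single remaining vertex
  would be sign connected to itself even in a balanced graph.\<close>

lemma (in signed_graph) sign_connected_delete_vertex_iff:
  assumes "card (verts G) \<ge> 3" "sign_connected G" "is_block G" "x \<in> verts G"
  shows "sign_connected (delete_vertex G x) \<longleftrightarrow> \<not> balanced (delete_vertex G x)"
proof -
  interpret D: signed_graph "delete_vertex G x" by (rule signed_graph_delete_vertex)
  show ?thesis
  proof
    assume sc: "sign_connected (delete_vertex G x)"
    have "\<not> card (verts G - {x}) \<le> 1" using assms(1,4) by (simp add: finite_verts)
    then obtain u w where "u \<in> verts G - {x}" "w \<in> verts G - {x}" "u \<noteq> w"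
      using finite_verts by (auto simp: card_le_Suc0_iff_eq)
    with sc have "joined_with_sign (delete_vertex G x) u 1 w"
      "joined_with_sign (delete_vertex G x) u (-1) w"
      by (auto simp: sign_connected_def sign_connected_verts_iff)
    \<comment> \<open>Going out positively and returning negatively gives a negative closed
      chain.\<close>
    then have "joined_with_sign (delete_vertex G x) u (1 * -1) u"
      by (blast intro: joined_with_sign_trans joined_with_sign_sym)
    then show "\<not> balanced (delete_vertex G x)" using D.balanced_iff by auto
  next
    assume "\<not> balanced (delete_vertex G x)"
    then show "sign_connected (delete_vertex G x)"
      using delete_vertex_connected[OF assms(2-4)] by (intro D.sign_connected_if_unbalanced) auto
  qed
qed

theorem theorem3p14:
  fixes G :: "('v, 'e) pre_signed_graph"
  assumes "signed_graph G"
    and "card (verts G) \<ge> 3"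
    and "sign_connected G"
    and "is_block G"
  shows "sign_block G \<longleftrightarrow> (\<nexists>x. balancing_vertex G x)"
  using signed_graph.sign_connected_delete_vertex_iff[OF assms] assms(3)
  by (auto simp: sign_block_def sign_articulation_vertex_def balancing_vertex_def)

end
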